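(* Let $(a_n)_{n\ge 1}$ be a sequence of real or complex numbers and let $(X_n)_{n\ge1}$ be a sequence of real or complex random variables on a common probability space such that $\mathbb{E}(|X_n|^2)=1$ for all $n$. Suppose that $$L:=\sum_{n,m=1}^\infty |a_n|\,|a_m|\,|\mathbb{E}(X_n\overline{X_m})|\,\log_2(n+1)\log_2(m+1)<\infty .$$ Then the series $\sum_{n=1}^\infty a_nX_n$ converges almost surely. Moreover, $$\mathbb{E}\left(\sup_{n\in\mathbb{N}}|a_1X_1+a_2X_2+\cdots+a_nX_n|^2\right)\le 8L .$$
   Context: $\log_2$ denotes the base-2 logarithm. No independence or orthogonality of the $X_n$ is assumed. *)

theory Defs
  imports "HOL-Probability.Probability"
begin

end

theory Submission
  imports Defs
begin

text \<open>
  Write \<open>s N\<close> for the sum of \<open>a\<^sub>n X\<^sub>n\<close> over \<open>1 \<le> n < N\<close>, and cut the indices into the blocks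
  \<open>[2\<^sup>k, 2\<^sup>k\<^sup>+\<^sup>1)\<close>. Any \<open>N\<close> in the \<open>k\<close>-th block is reached from \<open>1\<close> by the jumps over the
  blocks before it, followed by a move inside it, and these two parts are controlled separately.

  For the jumps, the Cauchy--Schwarz inequality with the weights \<open>c\<^sub>k = max(1, k)\<^sup>2\<close>, whose inverses
  have sum at most \<open>3\<close>, bounds the square of the sum of all norms of jumps by \<open>3 F\<close>, where \<open>F\<close>
  adds up \<open>c\<^sub>k\<close> times the squared norm of the \<open>k\<close>-th jump (\<open>sum_jumps_le\<close>). For the move inside
  a block, the binary expansion of \<open>N - 2\<^sup>k\<close> splits it into at most \<open>k\<close> increments over dyadic
  intervals, one for each level, so its square is at most \<open>k\<close> times the sum of the squared
  increments over all dyadic intervals of levels below \<open>k\<close> (\<open>dyadic_chaining\<close>); let \<open>G\<close> be the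
  sum of these bounds over all \<open>k\<close>. Hence \<open>|s N|\<^sup>2 \<le> 2 (3 F) + 2 G\<close> for all \<open>N\<close>, pointwise.

  The second moment of an increment over an interval \<open>I\<close> is at most the sum over \<open>I \<times> I\<close> of
  \<open>|a\<^sub>n| |a\<^sub>m| |E(X\<^sub>n cnj(X\<^sub>m))|\<close>. The squares \<open>I \<times> I\<close> of one level are disjoint parts of the square
  of the block, and there are \<open>k\<close> levels; so in expectation both the jump and the oscillation
  of the \<open>k\<close>-th block cost at most \<open>c\<^sub>k\<close> times the sum over the square of the block. Since
  \<open>log\<^sub>2(n + 1) \<ge> max(1, k)\<close> in this block, the logarithmic weights of \<open>L\<close> absorb \<open>c\<^sub>k\<close>. As the squares
  of the blocks are disjoint, \<open>E F \<le> L\<close> and \<open>E G \<le> L\<close>, and the constant is \<open>6 + 2 = 8\<close>.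

  Almost surely \<open>F\<close> and \<open>G\<close> are finite. Finiteness of \<open>F\<close> makes \<open>s\<close> converge along the powers
  of two, and finiteness of \<open>G\<close> makes the oscillation inside the blocks tend to zero.
\<close>

section \<open>Dyadic bounds for a single sequence\<close>

text \<open>
  Clearing the binary digits of \<open>j\<close> from the lowest one upwards leads from \<open>j\<close> to \<open>0\<close> in \<open>k\<close>
  steps. The step at level \<open>i\<close> is either trivial or crosses exactly one of the intervals
  \<open>[q 2\<^sup>i, (q + 1) 2\<^sup>i]\<close>. As the right-hand side does not mention \<open>j\<close>, it bounds the
  maximum over all \<open>j\<close>, and it can be integrated term by term.
\<close>

lemma dyadic_chaining:
  fixes P :: "nat \<Rightarrow> 'a::real_normed_vector"
  assumes "j < 2 ^ k"
  shows "(norm (P j - P 0))\<^sup>2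
    \<le> real k * (\<Sum>i<k. \<Sum>q<2 ^ (k - i). (norm (P (Suc q * 2 ^ i) - P (q * 2 ^ i)))\<^sup>2)"
proof -
  (* t i is j with its lowest i binary digits cleared. *)
  define t where "t i = j div 2 ^ i * 2 ^ i" for i
  define d where "d i = P (t i) - P (t (Suc i))" for i
  have d_le: "(norm (d i))\<^sup>2 \<le> (\<Sum>q<2 ^ (k - i). (norm (P (Suc q * 2 ^ i) - P (q * 2 ^ i)))\<^sup>2)"
    if "i < k" for i
  proof (cases "even (j div 2 ^ i)")
    case True
    then have "j div 2 ^ i = 2 * (j div 2 ^ Suc i)"
      by (metis div_mult2_eq dvd_mult_div_cancel power_Suc2)
    then have "t (Suc i) = t i"
      unfolding t_def by simp
    then show ?thesis
      by (simp add: d_def sum_nonneg)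
  next
    case False
    define q where "q = j div 2 ^ i - 1"
    have Suc_q: "j div 2 ^ i = Suc q"
      using False unfolding q_def by (metis Suc_pred' even_zero gr0I)
    have "2 * (j div 2 ^ Suc i) = q"
      using False unfolding q_def
      by (metis div_mult2_eq odd_two_times_div_two_nat power_Suc2)
    then have "t (Suc i) = q * 2 ^ i"
      unfolding t_def by (metis mult.assoc mult.commute power_Suc)
    moreover have "t i = Suc q * 2 ^ i"
      unfolding t_def Suc_q ..
    ultimately have d_eq: "d i = P (Suc q * 2 ^ i) - P (q * 2 ^ i)"
      unfolding d_def by (simp only:)
    have "j < 2 ^ (k - i) * 2 ^ i"
      using assms that by (simp flip: power_add)
    then have "q < 2 ^ (k - i)"
      using Suc_q by (metis Suc_lessD less_mult_imp_div_less)
    then show ?thesis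
      unfolding d_eq by (intro member_le_sum) auto
  qed
  have "P j - P 0 = (\<Sum>i<k. d i)"
    unfolding d_def sum_lessThan_telescope'[of "\<lambda>i. P (t i)"] using assms by (simp add: t_def)
  then have "(norm (P j - P 0))\<^sup>2 \<le> (\<Sum>i<k. norm (d i))\<^sup>2"
    by (intro power_mono) (auto intro: sum_norm_le)
  also have "\<dots> \<le> real k * (\<Sum>i<k. (norm (d i))\<^sup>2)"
    using sum_squared_le_sum_of_squares[of "\<lambda>i. norm (d i)" "{..<k}"] by (simp add: mult.commute)
  also have "\<dots> \<le> real k * (\<Sum>i<k. \<Sum>q<2 ^ (k - i). (norm (P (Suc q * 2 ^ i) - P (q * 2 ^ i)))\<^sup>2)"
    by (intro mult_left_mono sum_mono d_le) auto
  finally show ?thesis .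
qed

lemma sum_inverse_squares_le_3: "(\<Sum>i<k. 1 / (max 1 (real i))\<^sup>2) \<le> 3"
proof -
  (* From i = 2 on, 1 / i^2 is at most 1 / (i - 1) - 1 / i, and the sum telescopes. *)
  have "(\<Sum>i<Suc (Suc m). 1 / (max 1 (real i))\<^sup>2) \<le> 3 - 1 / real (Suc m)" for m
  proof (induction m)
    case (Suc m)
    have "1 / (max 1 (real (Suc (Suc m))))\<^sup>2 \<le> 1 / (real (Suc m) * real (Suc (Suc m)))"
      unfolding power2_eq_square by (intro divide_left_mono mult_mono) auto
    also have "\<dots> = 1 / real (Suc m) - 1 / real (Suc (Suc m))"
      by (simp add: field_simps)
    finally have "1 / (max 1 (real (Suc (Suc m))))\<^sup>2 \<le> 1 / real (Suc m) - 1 / real (Suc (Suc m))" .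
    with Suc show ?case
      by simp
  qed (simp add: numeral_2_eq_2)
  then have "(\<Sum>i<Suc (Suc k). 1 / (max 1 (real i))\<^sup>2) \<le> 3"
    by (rule order_trans) simp
  moreover have "(\<Sum>i<k. 1 / (max 1 (real i))\<^sup>2) \<le> (\<Sum>i<Suc (Suc k). 1 / (max 1 (real i))\<^sup>2)"
    by (intro sum_mono2) auto
  ultimately show ?thesis
    by linarith
qed

text \<open>
  The weight is \<open>max(1, k)\<^sup>2\<close>: its inverses must be summable, and it must not exceed the product of the
  logarithms of two indices of the \<open>k\<close>-th block.
\<close>

definition jump_energy :: "(nat \<Rightarrow> 'a::real_normed_vector) \<Rightarrow> nat \<Rightarrow> real" where
  "jump_energy s k = (max 1 (real k))\<^sup>2 * (norm (s (2 ^ Suc k) - s (2 ^ k)))\<^sup>2"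

text \<open>
  The chaining bound for the increments of \<open>s\<close> that start at the left end of the \<open>k\<close>-th block.
\<close>

definition osc_energy :: "(nat \<Rightarrow> 'a::real_normed_vector) \<Rightarrow> nat \<Rightarrow> real" where
  "osc_energy s k = real k * (\<Sum>i<k. \<Sum>q<2 ^ (k - i).
     (norm (s (2 ^ k + Suc q * 2 ^ i) - s (2 ^ k + q * 2 ^ i)))\<^sup>2)"

lemma jump_energy_nonneg: "0 \<le> jump_energy s k"
  by (simp add: jump_energy_def)

lemma osc_energy_nonneg: "0 \<le> osc_energy s k"
  by (simp add: osc_energy_def sum_nonneg)

text \<open>
  The bound is on the sum of the norms rather than on the norm of the sum. It therefore gives absolute
  convergence of the series of jumps as well as the maximal inequality along powers of two.
\<close>

lemma sum_jumps_le:
  "(\<Sum>i<k. norm (s (2 ^ Suc i) - s (2 ^ i)))\<^sup>2 \<le> 3 * (\<Sum>i<k. jump_energy s i)"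
proof -
  have "(\<Sum>i<k. norm (s (2 ^ Suc i) - s (2 ^ i)))
      = (\<Sum>i<k. (1 / max 1 (real i)) * (max 1 (real i) * norm (s (2 ^ Suc i) - s (2 ^ i))))"
    by (intro sum.cong) auto
  then have "(\<Sum>i<k. norm (s (2 ^ Suc i) - s (2 ^ i)))\<^sup>2
      \<le> (\<Sum>i<k. (1 / max 1 (real i))\<^sup>2) * (\<Sum>i<k. (max 1 (real i) * norm (s (2 ^ Suc i) - s (2 ^ i)))\<^sup>2)"
    using Cauchy_Schwarz_ineq_sum[of "\<lambda>i. 1 / max 1 (real i)"
        "\<lambda>i. max 1 (real i) * norm (s (2 ^ Suc i) - s (2 ^ i))" "{..<k}"]
    by simp
  also have "\<dots> = (\<Sum>i<k. 1 / (max 1 (real i))\<^sup>2) * (\<Sum>i<k. jump_energy s i)"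
    by (simp add: jump_energy_def power_mult_distrib power_divide)
  also have "\<dots> \<le> 3 * (\<Sum>i<k. jump_energy s i)"
    by (intro mult_right_mono sum_inverse_squares_le_3 sum_nonneg jump_energy_nonneg)
  finally show ?thesis .
qed

lemma osc_energy_bound:
  assumes "j < 2 ^ k"
  shows "(norm (s (2 ^ k + j) - s (2 ^ k)))\<^sup>2 \<le> osc_energy s k"
  using dyadic_chaining[OF assms, of "\<lambda>j. s (2 ^ k + j)"] by (simp add: osc_energy_def)

lemma dyadic_decomposition:
  assumes "1 \<le> (N::nat)"
  obtains k j where "N = 2 ^ k + j" "j < 2 ^ k"
proof -
  obtain k where "2 ^ k \<le> N" "N < 2 ^ (k + 1)"
    using ex_power_ivl1[of 2 N] assms by auto
  then show ?thesis
    using that[of k "N - 2 ^ k"] by auto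
qed

lemma norm_le_energies:
  assumes "s 1 = 0" and "1 \<le> N"
  shows "\<exists>k. (norm (s N))\<^sup>2 \<le> 6 * (\<Sum>i<k. jump_energy s i) + 2 * osc_energy s k"
proof -
  obtain k j where N: "N = 2 ^ k + j" "j < 2 ^ k"
    using dyadic_decomposition[OF assms(2)] .
  have "s (2 ^ k) = (\<Sum>i<k. s (2 ^ Suc i) - s (2 ^ i))"
    using assms(1) by (subst sum_lessThan_telescope) simp
  then have "norm (s (2 ^ k)) \<le> (\<Sum>i<k. norm (s (2 ^ Suc i) - s (2 ^ i)))"
    by (simp only: norm_sum)
  then have 1: "(norm (s (2 ^ k)))\<^sup>2 \<le> 3 * (\<Sum>i<k. jump_energy s i)"
    using sum_jumps_le[of s k] by (meson norm_ge_zero order_trans power_mono)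
  have 2: "(norm (s N - s (2 ^ k)))\<^sup>2 \<le> osc_energy s k"
    unfolding N(1) by (rule osc_energy_bound[OF N(2)])
  have "norm (s N) \<le> norm (s (2 ^ k)) + norm (s N - s (2 ^ k))"
    by (metis add.commute diff_add_cancel norm_triangle_ineq)
  then have "(norm (s N))\<^sup>2 \<le> (norm (s (2 ^ k)) + norm (s N - s (2 ^ k)))\<^sup>2"
    by (intro power_mono) auto
  also have "\<dots> \<le> 2 * (norm (s (2 ^ k)))\<^sup>2 + 2 * (norm (s N - s (2 ^ k)))\<^sup>2"
    using sum_squares_bound[of "norm (s (2 ^ k))" "norm (s N - s (2 ^ k))"]
    by (simp add: power2_sum)
  finally show ?thesis
    using 1 2 by (intro exI[of _ k]) linarith
qed

lemma norm_le_energies_ennreal: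
  assumes "s 1 = 0" and "1 \<le> N"
  shows "ennreal ((norm (s N))\<^sup>2)
    \<le> 6 * (\<Sum>k. ennreal (jump_energy s k)) + 2 * (\<Sum>k. ennreal (osc_energy s k))"
proof -
  obtain k where k: "(norm (s N))\<^sup>2 \<le> 6 * (\<Sum>i<k. jump_energy s i) + 2 * osc_energy s k"
    using norm_le_energies[of s, OF assms] by blast
  have "ennreal ((norm (s N))\<^sup>2) \<le> ennreal (6 * (\<Sum>i<k. jump_energy s i) + 2 * osc_energy s k)"
    using k by (rule ennreal_leI)
  also have "\<dots> = 6 * (\<Sum>i<k. ennreal (jump_energy s i)) + 2 * (\<Sum>i\<in>{k}. ennreal (osc_energy s i))"
    by (simp add: ennreal_plus ennreal_mult sum_ennreal jump_energy_nonneg osc_energy_nonneg sum_nonneg)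
  also have "\<dots> \<le> 6 * (\<Sum>k. ennreal (jump_energy s k)) + 2 * (\<Sum>k. ennreal (osc_energy s k))"
    by (intro add_mono mult_left_mono sum_le_suminf) auto
  finally show ?thesis .
qed

text \<open>
  The jumps form an absolutely convergent series, so \<open>s\<close> has a limit along the powers of two; at a
  general index, \<open>s\<close> differs from its value at the preceding power of two by at most the square root
  of an oscillation energy, and these tend to zero.
\<close>

lemma convergent_if_energies_summable:
  fixes s :: "nat \<Rightarrow> 'a::banach"
  assumes jump: "summable (jump_energy s)" and osc: "summable (osc_energy s)"
  shows "convergent s"
proof -
  have "(\<Sum>i<k. norm (s (2 ^ Suc i) - s (2 ^ i))) \<le> sqrt (3 * suminf (jump_energy s))" for k
  proof -
    have "(\<Sum>i<k. jump_energy s i) \<le> suminf (jump_energy s)"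
      by (intro sum_le_suminf jump) (auto simp: jump_energy_nonneg)
    then show ?thesis
      using sum_jumps_le[of s k] by (intro real_le_rsqrt) linarith
  qed
  then have "summable (\<lambda>i. norm (s (2 ^ Suc i) - s (2 ^ i)))"
    by (intro summableI_nonneg_bounded) auto
  then have "summable (\<lambda>i. s (2 ^ Suc i) - s (2 ^ i))"
    by (rule summable_norm_cancel)
  then have "convergent (\<lambda>k. \<Sum>i<k. s (2 ^ Suc i) - s (2 ^ i))"
    by (simp only: summable_iff_convergent)
  then have "convergent (\<lambda>k. s (2 ^ k) - s 1)"
    by (subst (asm) sum_lessThan_telescope) simp
  then obtain l where "(\<lambda>k. s (2 ^ k) - s 1) \<longlonglongrightarrow> l"
    by (auto simp: convergent_def)
  then have lim: "(\<lambda>k. s (2 ^ k)) \<longlonglongrightarrow> l + s 1"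
    using tendsto_add[OF _ tendsto_const[of "s 1"]] by fastforce
  have "s \<longlonglongrightarrow> l + s 1"
  proof (rule LIMSEQ_I)
    fix r :: real
    assume "0 < r"
    have "\<forall>\<^sub>F k in sequentially. dist (s (2 ^ k)) (l + s 1) < r / 2"
      using tendstoD[OF lim, of "r / 2"] \<open>0 < r\<close> by simp
    moreover have "\<forall>\<^sub>F k in sequentially. osc_energy s k < (r / 2)\<^sup>2"
      using order_tendstoD(2)[OF summable_LIMSEQ_zero[OF osc], of "(r / 2)\<^sup>2"] \<open>0 < r\<close> by simp
    ultimately have "\<forall>\<^sub>F k in sequentially. dist (s (2 ^ k)) (l + s 1) < r / 2
        \<and> osc_energy s k < (r / 2)\<^sup>2"
      by (rule eventually_conj)
    then obtain K where K: "\<And>k. K \<le> k \<Longrightarrow> norm (s (2 ^ k) - (l + s 1)) < r / 2"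
        "\<And>k. K \<le> k \<Longrightarrow> osc_energy s k < (r / 2)\<^sup>2"
      by (auto simp: eventually_sequentially dist_norm)
    show "\<exists>no. \<forall>n\<ge>no. norm (s n - (l + s 1)) < r"
    proof (intro exI allI impI)
      fix N :: nat
      assume N_ge: "2 ^ K \<le> N"
      then have "1 \<le> N"
        by (meson one_le_numeral one_le_power order_trans)
      then obtain k j where N: "N = 2 ^ k + j" "j < 2 ^ k"
        by (rule dyadic_decomposition)
      then have "(2::nat) ^ K < 2 ^ Suc k"
        using N_ge by simp
      then have "K < Suc k"
        by (rule power_less_imp_less_exp[rotated]) simp
      then have "K \<le> k"
        by simp
      have "(norm (s N - s (2 ^ k)))\<^sup>2 < (r / 2)\<^sup>2"
        unfolding N(1) using osc_energy_bound[OF N(2), of s] K(2)[OF \<open>K \<le> k\<close>] by (rule order_le_less_trans)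
      then have "norm (s N - s (2 ^ k)) < r / 2"
        by (rule power_less_imp_less_base) (use \<open>0 < r\<close> in simp)
      then show "norm (s N - (l + s 1)) < r"
        using K(1)[OF \<open>K \<le> k\<close>] by (rule norm_diff_triangle_less[THEN order_less_le_trans]) simp
    qed
  qed
  then show ?thesis
    by (rule convergentI)
qed

section \<open>Expected energies\<close>

lemma sum_squares_of_disjoint_le:
  fixes f :: "'i \<times> 'i \<Rightarrow> 'b::ordered_comm_monoid_add"
  assumes "finite B" and "finite I" and "disjoint_family_on A I"
    and "\<And>q. q \<in> I \<Longrightarrow> A q \<subseteq> B" and "\<And>p. 0 \<le> f p"
  shows "(\<Sum>q\<in>I. \<Sum>p\<in>A q \<times> A q. f p) \<le> (\<Sum>p\<in>B \<times> B. f p)"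
proof -
  have "(\<Sum>q\<in>I. \<Sum>p\<in>A q \<times> A q. f p) = (\<Sum>p\<in>(\<Union>q\<in>I. A q \<times> A q). f p)"
  proof (rule sum.UNION_disjoint[symmetric])
    show "\<forall>q\<in>I. finite (A q \<times> A q)"
      using finite_subset[OF assms(4) assms(1)] by blast
    show "\<forall>q\<in>I. \<forall>q'\<in>I. q \<noteq> q' \<longrightarrow> A q \<times> A q \<inter> A q' \<times> A q' = {}"
      using assms(3) by (auto simp: disjoint_family_on_def)
  qed fact
  also have "\<dots> \<le> (\<Sum>p\<in>B \<times> B. f p)"
    using assms(1,4,5) by (intro sum_mono2) auto
  finally show ?thesis .
qed

lemma log2_ge_block_index:
  assumes "2 ^ k \<le> n"
  shows "max 1 (real k) \<le> log 2 (real n + 1)"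
proof -
  have *: "(2::real) ^ k \<le> real n"
    using assms by (metis of_nat_le_iff of_nat_numeral of_nat_power)
  then have "real k \<le> log 2 (real n + 1)"
    by (simp add: le_log2_of_power flip: of_nat_Suc add.commute[of 1])
  moreover have "2 \<le> real n + 1"
    using assms by (smt (verit) * one_le_power)
  then have "1 \<le> log 2 (real n + 1)"
    by simp
  ultimately show ?thesis
    by simp
qed

text \<open>
  Expanding the square and applying the triangle inequality to the double sum of correlations takes
  the place of orthogonality. Square integrability is what allows the integral to be exchanged with
  the sum.
\<close>

lemma second_moment_le:
  fixes a :: "'i \<Rightarrow> complex" and X :: "'i \<Rightarrow> 'a \<Rightarrow> complex"
  assumes "finite A"
    and meas: "\<And>n. n \<in> A \<Longrightarrow> X n \<in> borel_measurable M"
    and int: "\<And>n. n \<in> A \<Longrightarrow> integrable M (\<lambda>\<omega>. (cmod (X n \<omega>))\<^sup>2)"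
  shows "(\<integral>\<^sup>+\<omega>. ennreal ((cmod (\<Sum>n\<in>A. a n * X n \<omega>))\<^sup>2) \<partial>M)
    \<le> ennreal (\<Sum>(n, m)\<in>A \<times> A. cmod (a n) * cmod (a m) * cmod (\<integral>\<omega>. X n \<omega> * cnj (X m \<omega>) \<partial>M))"
proof -
  define g where "g \<omega> = (cmod (\<Sum>n\<in>A. a n * X n \<omega>))\<^sup>2" for \<omega>
  have int2: "integrable M (\<lambda>\<omega>. X n \<omega> * cnj (X m \<omega>))" if "n \<in> A" "m \<in> A" for n m
  proof (rule Bochner_Integration.integrable_bound)
    show "integrable M (\<lambda>\<omega>. (cmod (X n \<omega>))\<^sup>2 + (cmod (X m \<omega>))\<^sup>2)"
      by (intro Bochner_Integration.integrable_add int that)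
    show "(\<lambda>\<omega>. X n \<omega> * cnj (X m \<omega>)) \<in> borel_measurable M"
      using borel_measurable_continuous_on[OF continuous_on_cnj[OF continuous_on_id] meas[OF that(2)]]
      by (intro borel_measurable_times meas that) (simp_all add: id_def)
    show "AE \<omega> in M. norm (X n \<omega> * cnj (X m \<omega>)) \<le> norm ((cmod (X n \<omega>))\<^sup>2 + (cmod (X m \<omega>))\<^sup>2)"
    proof (rule AE_I2)
      fix \<omega>
      have "0 \<le> cmod (X n \<omega>) * cmod (X m \<omega>)"
        by simp
      then have "cmod (X n \<omega>) * cmod (X m \<omega>) \<le> (cmod (X n \<omega>))\<^sup>2 + (cmod (X m \<omega>))\<^sup>2"
        using sum_squares_bound[of "cmod (X n \<omega>)" "cmod (X m \<omega>)"] by linarith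
      then show "norm (X n \<omega> * cnj (X m \<omega>)) \<le> norm ((cmod (X n \<omega>))\<^sup>2 + (cmod (X m \<omega>))\<^sup>2)"
        by (simp add: norm_mult)
    qed
  qed
  have expand: "complex_of_real (g \<omega>)
      = (\<Sum>(n, m)\<in>A \<times> A. a n * cnj (a m) * (X n \<omega> * cnj (X m \<omega>)))" for \<omega>
    unfolding g_def complex_norm_square cnj_sum sum_product sum.cartesian_product
    by (intro sum.cong) (auto simp: mult_ac)
  have int3: "integrable M (\<lambda>\<omega>. a n * cnj (a m) * (X n \<omega> * cnj (X m \<omega>)))"
    if "n \<in> A" "m \<in> A" for n m
    using int2[OF that] by simp
  have g_cint: "integrable M (\<lambda>\<omega>. complex_of_real (g \<omega>))"
    unfolding expand by (intro Bochner_Integration.integrable_sum) (auto intro!: int3)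
  then have g_int: "integrable M g"
    by (metis complex_of_real_integrable_eq)
  have "complex_of_real (\<integral>\<omega>. g \<omega> \<partial>M) = (\<integral>\<omega>. complex_of_real (g \<omega>) \<partial>M)"
    by simp
  also have "\<dots> = (\<Sum>(n, m)\<in>A \<times> A. a n * cnj (a m) * (\<integral>\<omega>. X n \<omega> * cnj (X m \<omega>) \<partial>M))"
    unfolding expand
    by (subst Bochner_Integration.integral_sum) (auto intro!: int3 sum.cong simp: int2)
  finally have "cmod (complex_of_real (\<integral>\<omega>. g \<omega> \<partial>M))
      \<le> (\<Sum>(n, m)\<in>A \<times> A. cmod (a n) * cmod (a m) * cmod (\<integral>\<omega>. X n \<omega> * cnj (X m \<omega>) \<partial>M))"
    by (auto intro!: sum_norm_le simp: norm_mult split_beta)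
  then have "(\<integral>\<omega>. g \<omega> \<partial>M)
      \<le> (\<Sum>(n, m)\<in>A \<times> A. cmod (a n) * cmod (a m) * cmod (\<integral>\<omega>. X n \<omega> * cnj (X m \<omega>) \<partial>M))"
    by simp
  then show ?thesis
    using nn_integral_eq_integral[OF g_int] by (simp add: g_def[abs_def] ennreal_leI)
qed

definition block :: "nat \<Rightarrow> nat set" where
  "block k = {2 ^ k..<2 ^ Suc k}"

text \<open>
  Only correlations between indices of the same block enter the bounds below, and the squares of the
  blocks are disjoint subsets of the index set of \<open>L\<close>.
\<close>

lemma sum_block_squares_le_infsum:
  fixes W :: "nat \<times> nat \<Rightarrow> ennreal"
  shows "(\<Sum>k. \<Sum>p\<in>block k \<times> block k. W p) \<le> (\<Sum>\<^sub>\<infinity>p\<in>{1..} \<times> {1..}. W p)"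
proof (rule suminf_le_const)
  fix K
  have disj: "disjoint_family_on block {..<K}"
  proof -
    have "x \<notin> block l" if "x \<in> block k" "k < l" for x k l
    proof -
      have "(2::nat) ^ Suc k \<le> 2 ^ l"
        using that(2) by (intro power_increasing) auto
      then show ?thesis
        using that(1) by (auto simp: block_def)
    qed
    then show ?thesis
      unfolding disjoint_family_on_def by (metis disjoint_iff linorder_neqE_nat)
  qed
  have "(\<Sum>k<K. \<Sum>p\<in>block k \<times> block k. W p) \<le> (\<Sum>p\<in>{1..<2 ^ K} \<times> {1..<2 ^ K}. W p)"
  proof (rule sum_squares_of_disjoint_le[OF _ _ disj])
    fix k
    assume "k \<in> {..<K}"
    then have "(2::nat) ^ Suc k \<le> 2 ^ K"
      by (intro power_increasing) auto
    moreover have "(1::nat) \<le> 2 ^ k"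
      by simp
    ultimately show "block k \<subseteq> {1..<2 ^ K}"
      by (auto simp: block_def)
  qed auto
  also have "\<dots> = (\<Sum>\<^sub>\<infinity>p\<in>{1..<2 ^ K} \<times> {1..<2 ^ K}. W p)"
    by simp
  also have "\<dots> \<le> (\<Sum>\<^sub>\<infinity>p\<in>{1..} \<times> {1..}. W p)"
    by (intro infsum_mono_neutral nonneg_summable_on_complete) auto
  finally show "(\<Sum>k<K. \<Sum>p\<in>block k \<times> block k. W p) \<le> (\<Sum>\<^sub>\<infinity>p\<in>{1..} \<times> {1..}. W p)" .
qed simp

lemma dyadic_subintervals_of_block:
  assumes "i < k"
  shows "disjoint_family_on (\<lambda>q. {2 ^ k + q * 2 ^ i..<2 ^ k + Suc q * 2 ^ i}) {..<2 ^ (k - i)}"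
    and "q < 2 ^ (k - i) \<Longrightarrow> {2 ^ k + q * 2 ^ i..<2 ^ k + Suc q * 2 ^ i} \<subseteq> block k"
proof -
  have "x \<notin> {2 ^ k + q' * 2 ^ i..<2 ^ k + Suc q' * 2 ^ i}"
    if "x \<in> {2 ^ k + q * 2 ^ i..<2 ^ k + Suc q * 2 ^ i}" "q < q'" for x q q' :: nat
  proof -
    have "Suc q * 2 ^ i \<le> q' * 2 ^ i"
      using that(2) by (intro mult_right_mono) auto
    then show ?thesis
      using that(1) by (simp only: atLeastLessThan_iff) linarith
  qed
  then show "disjoint_family_on (\<lambda>q. {2 ^ k + q * 2 ^ i..<2 ^ k + Suc q * 2 ^ i}) {..<2 ^ (k - i)}"
    unfolding disjoint_family_on_def by (metis disjoint_iff linorder_neqE_nat)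
next
  assume "q < 2 ^ (k - i)"
  then have "Suc q * 2 ^ i \<le> 2 ^ (k - i) * 2 ^ i"
    by (intro mult_right_mono) auto
  also have "\<dots> = (2::nat) ^ k"
    using assms by (simp flip: power_add)
  finally show "{2 ^ k + q * 2 ^ i..<2 ^ k + Suc q * 2 ^ i} \<subseteq> block k"
    unfolding block_def by (intro ivl_subset[THEN iffD2] disjI2) auto
qed

lemma expected_jump_energy_le:
  fixes s :: "'a \<Rightarrow> nat \<Rightarrow> 'b::{real_normed_vector, second_countable_topology}"
  assumes meas: "\<And>N. (\<lambda>\<omega>. s \<omega> N) \<in> borel_measurable M"
    and moment: "\<And>u v. 1 \<le> u \<Longrightarrow> u \<le> v \<Longrightarrow>
      (\<integral>\<^sup>+\<omega>. ennreal ((norm (s \<omega> v - s \<omega> u))\<^sup>2) \<partial>M) \<le> ennreal (\<Sum>p\<in>{u..<v} \<times> {u..<v}. r p)"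
  shows "(\<integral>\<^sup>+\<omega>. ennreal (jump_energy (s \<omega>) k) \<partial>M)
    \<le> ennreal ((max 1 (real k))\<^sup>2 * (\<Sum>p\<in>block k \<times> block k. r p))"
proof -
  note [measurable] = meas
  have "(\<integral>\<^sup>+\<omega>. ennreal (jump_energy (s \<omega>) k) \<partial>M)
      = ennreal ((max 1 (real k))\<^sup>2) * (\<integral>\<^sup>+\<omega>. ennreal ((norm (s \<omega> (2 ^ Suc k) - s \<omega> (2 ^ k)))\<^sup>2) \<partial>M)"
    unfolding jump_energy_def by (simp only: ennreal_mult' zero_le_power2) (simp add: nn_integral_cmult)
  also have "\<dots> \<le> ennreal ((max 1 (real k))\<^sup>2) * ennreal (\<Sum>p\<in>block k \<times> block k. r p)"
    unfolding block_def by (intro mult_left_mono moment) auto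
  also have "\<dots> = ennreal ((max 1 (real k))\<^sup>2 * (\<Sum>p\<in>block k \<times> block k. r p))"
    by (simp only: ennreal_mult' zero_le_power2)
  finally show ?thesis .
qed

text \<open>
  One factor \<open>k\<close> comes from the definition of the oscillation energy, the other from the
  number of levels: the dyadic intervals of a single level have disjoint squares, so each level costs at
  most the sum over the square of the block.
\<close>

lemma expected_osc_energy_le:
  fixes s :: "'a \<Rightarrow> nat \<Rightarrow> 'b::{real_normed_vector, second_countable_topology}"
  assumes meas: "\<And>N. (\<lambda>\<omega>. s \<omega> N) \<in> borel_measurable M"
    and moment: "\<And>u v. 1 \<le> u \<Longrightarrow> u \<le> v \<Longrightarrow>
      (\<integral>\<^sup>+\<omega>. ennreal ((norm (s \<omega> v - s \<omega> u))\<^sup>2) \<partial>M) \<le> ennreal (\<Sum>p\<in>{u..<v} \<times> {u..<v}. r p)"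
    and r: "\<And>p. 0 \<le> r p"
  shows "(\<integral>\<^sup>+\<omega>. ennreal (osc_energy (s \<omega>) k) \<partial>M)
    \<le> ennreal ((real k)\<^sup>2 * (\<Sum>p\<in>block k \<times> block k. r p))"
proof -
  note [measurable] = meas
  let ?I = "\<lambda>i q. {2 ^ k + q * 2 ^ i..<2 ^ k + Suc q * 2 ^ i}"
  have "(\<integral>\<^sup>+\<omega>. ennreal (osc_energy (s \<omega>) k) \<partial>M)
      = ennreal (real k) * (\<Sum>i<k. \<Sum>q<2 ^ (k - i).
          \<integral>\<^sup>+\<omega>. ennreal ((norm (s \<omega> (2 ^ k + Suc q * 2 ^ i) - s \<omega> (2 ^ k + q * 2 ^ i)))\<^sup>2) \<partial>M)"
    unfolding osc_energy_def
    by (simp add: ennreal_mult sum_nonneg nn_integral_cmult nn_integral_sum flip: sum_ennreal)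
  also have "\<dots> \<le> ennreal (real k) * (\<Sum>i<k. \<Sum>q<2 ^ (k - i). ennreal (\<Sum>p\<in>?I i q \<times> ?I i q. r p))"
    by (intro mult_left_mono sum_mono moment) (auto intro: trans_le_add1)
  also have "\<dots> = ennreal (real k * (\<Sum>i<k. \<Sum>q<2 ^ (k - i). \<Sum>p\<in>?I i q \<times> ?I i q. r p))"
    by (simp add: ennreal_mult sum_ennreal sum_nonneg r)
  also have "\<dots> \<le> ennreal (real k * (\<Sum>i<k. \<Sum>p\<in>block k \<times> block k. r p))"
  proof (intro ennreal_leI mult_left_mono sum_mono)
    fix i
    assume "i \<in> {..<k}"
    then show "(\<Sum>q<2 ^ (k - i). \<Sum>p\<in>?I i q \<times> ?I i q. r p) \<le> (\<Sum>p\<in>block k \<times> block k. r p)"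
      by (intro sum_squares_of_disjoint_le dyadic_subintervals_of_block r) (auto simp: block_def)
  qed auto
  also have "\<dots> = ennreal ((real k)\<^sup>2 * (\<Sum>p\<in>block k \<times> block k. r p))"
    by (simp add: power2_eq_square mult.assoc)
  finally show ?thesis .
qed

text \<open>
  Here the logarithmic weights are used up. The constant \<open>c\<close> is \<open>max(1, k)\<close> for the jumps and \<open>k\<close> for the
  oscillations.
\<close>

lemma weighted_block_square_le:
  assumes r: "\<And>p. 0 \<le> r p" and c: "0 \<le> c" "c \<le> max 1 (real k)"
  shows "ennreal (c\<^sup>2 * (\<Sum>p\<in>block k \<times> block k. r p))
    \<le> (\<Sum>(n, m)\<in>block k \<times> block k. ennreal (r (n, m) * log 2 (real n + 1) * log 2 (real m + 1)))"
proof -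
  have log_ge: "c \<le> log 2 (real n + 1)" if "n \<in> block k" for n
    using that by (intro order_trans[OF c(2) log2_ge_block_index]) (simp add: block_def)
  have "c\<^sup>2 * r (n, m) \<le> r (n, m) * log 2 (real n + 1) * log 2 (real m + 1)"
    if "n \<in> block k" "m \<in> block k" for n m
  proof -
    have "c * c \<le> log 2 (real n + 1) * log 2 (real m + 1)"
      using c log_ge[OF that(1)] log_ge[OF that(2)] by (intro mult_mono) auto
    from mult_left_mono[OF this r[of "(n, m)"]] show ?thesis
      by (simp add: power2_eq_square mult_ac)
  qed
  then have "(\<Sum>(n, m)\<in>block k \<times> block k. ennreal (c\<^sup>2 * r (n, m)))
      \<le> (\<Sum>(n, m)\<in>block k \<times> block k. ennreal (r (n, m) * log 2 (real n + 1) * log 2 (real m + 1)))"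
    by (intro sum_mono) (auto intro: ennreal_leI)
  moreover have "(\<Sum>(n, m)\<in>block k \<times> block k. ennreal (c\<^sup>2 * r (n, m)))
      = ennreal (c\<^sup>2 * (\<Sum>p\<in>block k \<times> block k. r p))"
    using r by (simp add: sum_distrib_left sum_ennreal split_beta)
  ultimately show ?thesis
    by simp
qed

section \<open>The maximal inequality\<close>

text \<open>
  The correlations enter only through a nonnegative kernel \<open>r\<close> that bounds the second moments of the
  increments of \<open>s\<close>. The energies \<open>F\<close> and \<open>G\<close> dominate \<open>s\<close> pointwise with the constants \<open>6\<close> and \<open>2\<close>, and
  each has expectation at most \<open>L\<close>.
\<close>

lemma rademacher_menshov:
  fixes s :: "'a \<Rightarrow> nat \<Rightarrow> 'b::{banach, second_countable_topology}"
  assumes start: "\<And>\<omega>. s \<omega> 1 = 0"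
    and meas: "\<And>N. (\<lambda>\<omega>. s \<omega> N) \<in> borel_measurable M"
    and moment: "\<And>u v. 1 \<le> u \<Longrightarrow> u \<le> v \<Longrightarrow>
      (\<integral>\<^sup>+\<omega>. ennreal ((norm (s \<omega> v - s \<omega> u))\<^sup>2) \<partial>M) \<le> ennreal (\<Sum>p\<in>{u..<v} \<times> {u..<v}. r p)"
    and r: "\<And>p. 0 \<le> r p"
    and L: "L = (\<Sum>\<^sub>\<infinity>(n, m)\<in>{1..} \<times> {1..}. ennreal (r (n, m) * log 2 (real n + 1) * log 2 (real m + 1)))"
    and fin: "L < \<infinity>"
  shows "AE \<omega> in M. convergent (s \<omega>)"
    and "(\<integral>\<^sup>+\<omega>. (SUP N\<in>{1..}. ennreal ((norm (s \<omega> N))\<^sup>2)) \<partial>M) \<le> 8 * L"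
proof -
  define W where "W k = (\<Sum>(n, m)\<in>block k \<times> block k.
      ennreal (r (n, m) * log 2 (real n + 1) * log 2 (real m + 1)))" for k
  define F where "F \<omega> = (\<Sum>k. ennreal (jump_energy (s \<omega>) k))" for \<omega>
  define G where "G \<omega> = (\<Sum>k. ennreal (osc_energy (s \<omega>) k))" for \<omega>
  note [measurable] = meas
  have jump_meas [measurable]: "(\<lambda>\<omega>. jump_energy (s \<omega>) k) \<in> borel_measurable M" for k
    unfolding jump_energy_def by measurable
  have osc_meas [measurable]: "(\<lambda>\<omega>. osc_energy (s \<omega>) k) \<in> borel_measurable M" for k
    unfolding osc_energy_def by measurable
  have F_meas [measurable]: "F \<in> borel_measurable M" and G_meas [measurable]: "G \<in> borel_measurable M"
    unfolding F_def[abs_def] G_def[abs_def] by measurable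
  have W_le: "(\<Sum>k. W k) \<le> L"
    unfolding W_def L by (rule sum_block_squares_le_infsum)
  have "(\<integral>\<^sup>+\<omega>. F \<omega> \<partial>M) = (\<Sum>k. \<integral>\<^sup>+\<omega>. ennreal (jump_energy (s \<omega>) k) \<partial>M)"
    unfolding F_def by (rule nn_integral_suminf) simp
  also have "\<dots> \<le> (\<Sum>k. W k)"
    unfolding W_def
    by (intro suminf_le expected_jump_energy_le[OF meas moment, THEN order_trans]
        weighted_block_square_le r) auto
  finally have F_int: "(\<integral>\<^sup>+\<omega>. F \<omega> \<partial>M) \<le> L"
    using W_le by (rule order_trans)
  have "(\<integral>\<^sup>+\<omega>. G \<omega> \<partial>M) = (\<Sum>k. \<integral>\<^sup>+\<omega>. ennreal (osc_energy (s \<omega>) k) \<partial>M)"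
    unfolding G_def by (rule nn_integral_suminf) simp
  also have "\<dots> \<le> (\<Sum>k. W k)"
    unfolding W_def
    by (intro suminf_le expected_osc_energy_le[OF meas moment r, THEN order_trans]
        weighted_block_square_le r) auto
  finally have G_int: "(\<integral>\<^sup>+\<omega>. G \<omega> \<partial>M) \<le> L"
    using W_le by (rule order_trans)
  have "AE \<omega> in M. F \<omega> \<noteq> \<infinity>" "AE \<omega> in M. G \<omega> \<noteq> \<infinity>"
    using F_int G_int fin by (auto intro!: nn_integral_PInf_AE[unfolded infinity_ennreal_def])
  then show "AE \<omega> in M. convergent (s \<omega>)"
  proof eventually_elim
    case (elim \<omega>)
    then show ?case
      unfolding F_def G_def
      by (intro convergent_if_energies_summable summable_suminf_not_top jump_energy_nonneg
          osc_energy_nonneg) auto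
  qed
  have "(\<integral>\<^sup>+\<omega>. (SUP N\<in>{1..}. ennreal ((norm (s \<omega> N))\<^sup>2)) \<partial>M) \<le> (\<integral>\<^sup>+\<omega>. 6 * F \<omega> + 2 * G \<omega> \<partial>M)"
    unfolding F_def G_def
    by (intro nn_integral_mono SUP_least norm_le_energies_ennreal start) auto
  also have "\<dots> = 6 * (\<integral>\<^sup>+\<omega>. F \<omega> \<partial>M) + 2 * (\<integral>\<^sup>+\<omega>. G \<omega> \<partial>M)"
    by (simp add: nn_integral_add nn_integral_cmult)
  also have "\<dots> \<le> 6 * L + 2 * L"
    by (intro add_mono mult_left_mono F_int G_int) auto
  also have "\<dots> = 8 * L"
    by (simp flip: distrib_right)
  finally show "(\<integral>\<^sup>+\<omega>. (SUP N\<in>{1..}. ennreal ((norm (s \<omega> N))\<^sup>2)) \<partial>M) \<le> 8 * L" .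
qed

theorem theorem1:
  fixes M :: "'a measure" and a :: "nat \<Rightarrow> complex"
    and X :: "nat \<Rightarrow> 'a \<Rightarrow> complex" and L :: ennreal
  assumes "prob_space M"
    and "\<And>n. n \<ge> 1 \<Longrightarrow> X n \<in> borel_measurable M"
    and "\<And>n. n \<ge> 1 \<Longrightarrow> (\<integral>\<omega>. (cmod (X n \<omega>))\<^sup>2 \<partial>M) = 1"
    and "L = (\<Sum>\<^sub>\<infinity>(n, m)\<in>{1..} \<times> {1..}.
           ennreal (cmod (a n) * cmod (a m) * cmod (\<integral>\<omega>. X n \<omega> * cnj (X m \<omega>) \<partial>M)
             * log 2 (real n + 1) * log 2 (real m + 1)))"
    and "L < \<infinity>"
  shows "(AE \<omega> in M. convergent (\<lambda>N. \<Sum>n=1..N. a n * X n \<omega>)) \<and>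
         (\<integral>\<^sup>+\<omega>. (SUP N\<in>{1..}. ennreal ((cmod (\<Sum>n=1..N. a n * X n \<omega>))\<^sup>2)) \<partial>M) \<le> 8 * L"
proof -
  define s where "s \<omega> N = (\<Sum>n\<in>{1..<N}. a n * X n \<omega>)" for \<omega> and N :: nat
  define r where "r = (\<lambda>(n, m). cmod (a n) * cmod (a m) * cmod (\<integral>\<omega>. X n \<omega> * cnj (X m \<omega>) \<partial>M))"
  have partial_sum: "(\<Sum>n=1..N. a n * X n \<omega>) = s \<omega> (Suc N)" for N \<omega>
    by (simp add: s_def atLeastLessThanSuc_atLeastAtMost)
  have meas: "(\<lambda>\<omega>. s \<omega> N) \<in> borel_measurable M" for N
    unfolding s_def using assms(2) by (intro borel_measurable_sum borel_measurable_times) auto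
  (* The Bochner integral of a function that is not integrable is 0, so the value 1 implies
     integrability. *)
  have square_int: "integrable M (\<lambda>\<omega>. (cmod (X n \<omega>))\<^sup>2)" if "n \<ge> 1" for n
    using assms(3)[OF that] not_integrable_integral_eq by fastforce
  have moment: "(\<integral>\<^sup>+\<omega>. ennreal ((norm (s \<omega> v - s \<omega> u))\<^sup>2) \<partial>M)
      \<le> ennreal (\<Sum>p\<in>{u..<v} \<times> {u..<v}. r p)" if "1 \<le> u" "u \<le> v" for u v
  proof -
    have "s \<omega> v - s \<omega> u = (\<Sum>n\<in>{u..<v}. a n * X n \<omega>)" for \<omega>
      unfolding s_def using that by (metis sum_diff_nat_ivl)
    then show ?thesis
      unfolding r_def using that by (auto intro!: second_moment_le assms(2) square_int)
  qed
  have L: "L = (\<Sum>\<^sub>\<infinity>(n, m)\<in>{1..} \<times> {1..}. ennreal (r (n, m) * log 2 (real n + 1) * log 2 (real m + 1)))"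
    unfolding assms(4) r_def by simp
  have r: "0 \<le> r p" for p
    by (simp add: r_def split_beta)
  have start: "s \<omega> 1 = 0" for \<omega>
    by (simp add: s_def)
  note main = rademacher_menshov[OF start meas moment r L assms(5)]
  have "AE \<omega> in M. convergent (\<lambda>N. \<Sum>n=1..N. a n * X n \<omega>)"
    using main(1) unfolding partial_sum by (simp only: convergent_Suc_iff)
  moreover have "(\<integral>\<^sup>+\<omega>. (SUP N\<in>{1..}. ennreal ((cmod (\<Sum>n=1..N. a n * X n \<omega>))\<^sup>2)) \<partial>M)
      \<le> (\<integral>\<^sup>+\<omega>. (SUP N\<in>{1..}. ennreal ((norm (s \<omega> N))\<^sup>2)) \<partial>M)"
    unfolding partial_sum by (intro nn_integral_mono SUP_least SUP_upper) auto
  ultimately show ?thesis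
    using main(2) by (auto intro: order_trans)
qed

end
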